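(* Let $(\mathfrak{D}_1,\dots,\mathfrak{D}_d)$ be a system of delta operators on $\mathbb{R}[x_1,\dots,x_d]$, and let $f_i$ be the indicator of $\mathfrak{D}_i$. Then $(\mathfrak{D}_1,\dots,\mathfrak{D}_d)$ is a strict system of delta operators if and only if for each $i$ there is a formal power series $g_i(\mathbf{x})\in\mathbb{R}[[x_1,\dots,x_d]]$ with $g_i(\mathbf{0})\neq 0$ such that $f_i(\mathbf{x})=x_i\,g_i(\mathbf{x})$.
   Context: For $\mathbf{v}\in\mathbb{R}^d$, $\mathfrak{E}_{\mathbf{v}}$ denotes the shift $f(\mathbf{x})\mapsto f(\mathbf{x}+\mathbf{v})$ on $\mathbb{R}[\mathbf{x}]$; a linear operator is shift-invariant if it commutes with all $\mathfrak{E}_{\mathbf{v}}$. Every shift-invariant linear operator is uniquely of the form $\sum_{\mathbf{n}\in\mathbb{N}^d}a_{\mathbf{n}}D_1^{n_1}\cdots D_d^{n_d}$ with $D_i=\partial/\partial x_i$; its indicator is $\sum_{\mathbf{n}}a_{\mathbf{n}}\mathbf{x}^{\mathbf{n}}$. A $d$-tuple of shift-invariant linear operators $(\mathfrak{D}_1,\dots,\mathfrak{D}_d)$ is a system of delta operators if for every nonzero polynomial $p=a_1x_1+\cdots+a_dx_d$, each $\mathfrak{D}_ip$ is a real constant $c_i$, and some $c_i\ne 0$. The degree of a polynomial $p$ with respect to $x_i$ is the largest $m$ such that $x_i^m$ divides some monomial appearing in $p$ with nonzero coefficient. The system is strict if for each $i$ and every polynomial $p$ of degree $m$ with respect to $x_i$: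 if $m\ge1$ then $\mathfrak{D}_ip$ has degree $m-1$ with respect to $x_i$, and if $m=0$ then $\mathfrak{D}_ip=0$. *)

theory Defs
  imports "HOL-Library.Poly_Mapping" "HOL-Analysis.Finite_Cartesian_Product"
begin

text \<open>
  The variables are indexed by a finite type \<open>'d\<close>, with \<open>d = CARD('d)\<close>.  A monomial is
  identified with its exponent \<open>n :: 'd \<Rightarrow>\<^sub>0 nat\<close>, and \<open>\<real>[x]\<close> is the monoid algebra
  over the exponents.  Power series are arbitrary coefficient functions on the exponents.
\<close>

type_synonym 'd mpoly = "('d \<Rightarrow>\<^sub>0 nat) \<Rightarrow>\<^sub>0 real"
type_synonym 'd mfps = "('d \<Rightarrow>\<^sub>0 nat) \<Rightarrow> real"

definition mconst :: "real \<Rightarrow> 'd mpoly" where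
  "mconst c = Poly_Mapping.single 0 c"

definition mvar :: "'d \<Rightarrow> 'd mpoly" where
  "mvar i = Poly_Mapping.single (Poly_Mapping.single i 1) 1"

definition mscale :: "real \<Rightarrow> 'd mpoly \<Rightarrow> 'd mpoly" where
  "mscale c p = Poly_Mapping.map ((*) c) p"

definition shift :: "real ^ 'd \<Rightarrow> 'd::finite mpoly \<Rightarrow> 'd mpoly" where
  "shift v p =
    (\<Sum>n\<in>Poly_Mapping.keys p.
      mscale (Poly_Mapping.lookup p n)
        (\<Prod>i\<in>UNIV. (mvar i + mconst (v $ i)) ^ Poly_Mapping.lookup n i))"

definition shift_invariant :: "('d::finite mpoly \<Rightarrow> 'd mpoly) \<Rightarrow> bool" where
  "shift_invariant T \<longleftrightarrow>
    Vector_Spaces.linear mscale mscale T \<and> (\<forall>v p. T (shift v p) = shift v (T p))"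

text \<open>
  Subtraction of exponents is truncated; the terms where truncation occurs have factor \<open>0\<close>.
\<close>

definition partial_deriv :: "'d \<Rightarrow> 'd mpoly \<Rightarrow> 'd mpoly" where
  "partial_deriv i p =
    (\<Sum>n\<in>Poly_Mapping.keys p.
      Poly_Mapping.single (n - Poly_Mapping.single i 1)
        (real (Poly_Mapping.lookup n i) * Poly_Mapping.lookup p n))"

text \<open>
  The iterated derivative \<open>D\<^sub>1\<^bsup>n1\<^esup> \<dots> D\<^sub>d\<^bsup>nd\<^esup> p\<close>.  The fold is independent of the order of the
  variables because partial derivatives commute (shown below).
\<close>

definition iter_deriv :: "('d::finite \<Rightarrow>\<^sub>0 nat) \<Rightarrow> 'd mpoly \<Rightarrow> 'd mpoly" where
  "iter_deriv n p =
    Finite_Set.fold (\<lambda>i. partial_deriv i ^^ Poly_Mapping.lookup n i) p UNIV"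

text \<open>
  The operator \<open>\<Sum>\<^sub>n a\<^sub>n D\<^sup>n\<close>; for each \<open>p\<close> only finitely many terms are nonzero (shown below).
\<close>

definition series_op :: "'d::finite mfps \<Rightarrow> 'd mpoly \<Rightarrow> 'd mpoly" where
  "series_op a p = Sum_any (\<lambda>n. mscale (a n) (iter_deriv n p))"

text \<open>Meaningful for shift-invariant \<open>T\<close>, for which the expansion exists and is unique.\<close>

definition op_indicator :: "('d::finite mpoly \<Rightarrow> 'd mpoly) \<Rightarrow> 'd mfps" where
  "op_indicator T = (THE a. T = series_op a)"

definition delta_system :: "('d::finite \<Rightarrow> 'd mpoly \<Rightarrow> 'd mpoly) \<Rightarrow> bool" where
  "delta_system T \<longleftrightarrow>
    (\<forall>i. shift_invariant (T i)) \<and>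
    (\<forall>a. (\<Sum>j\<in>UNIV. mscale (a j) (mvar j)) \<noteq> 0 \<longrightarrow>
      (\<exists>c. (\<forall>i. T i (\<Sum>j\<in>UNIV. mscale (a j) (mvar j)) = mconst (c i)) \<and>
           (\<exists>i. c i \<noteq> 0)))"

text \<open>
  \<open>m\<close> is the largest number such that \<open>x\<^sub>i\<^sup>m\<close> divides some monomial of \<open>p\<close>.  This is a relation
  since the zero polynomial has no degree.
\<close>

definition has_degree_in :: "'d \<Rightarrow> 'd mpoly \<Rightarrow> nat \<Rightarrow> bool" where
  "has_degree_in i p m \<longleftrightarrow>
    (\<exists>n\<in>Poly_Mapping.keys p. m \<le> Poly_Mapping.lookup n i) \<and>
    (\<forall>n\<in>Poly_Mapping.keys p. Poly_Mapping.lookup n i \<le> m)"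

definition strict_delta_system :: "('d::finite \<Rightarrow> 'd mpoly \<Rightarrow> 'd mpoly) \<Rightarrow> bool" where
  "strict_delta_system T \<longleftrightarrow>
    delta_system T \<and>
    (\<forall>i p m. has_degree_in i p m \<longrightarrow>
      (m \<ge> 1 \<longrightarrow> has_degree_in i (T i p) (m - 1)) \<and>
      (m = 0 \<longrightarrow> T i p = 0))"

definition mfps_var :: "'d \<Rightarrow> 'd mfps" where
  "mfps_var i n = (if n = Poly_Mapping.single i 1 then 1 else 0)"

text \<open>Cauchy product; every exponent is a sum of two exponents in finitely many ways.\<close>

definition mfps_mult :: "'d::finite mfps \<Rightarrow> 'd mfps \<Rightarrow> 'd mfps" where
  "mfps_mult f g n = (\<Sum>(k, l) | k + l = n. f k * g l)"

lemma lookup_mscale [simp]: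
  "Poly_Mapping.lookup (mscale c p) n = c * Poly_Mapping.lookup p n"
by (simp add: mscale_def map.rep_eq when_def)

lemma vector_space_mscale: "vector_space mscale"
  by unfold_locales (auto intro!: poly_mapping_eqI simp: lookup_add algebra_simps)

lemma lookup_partial_deriv:
  "Poly_Mapping.lookup (partial_deriv i p) m =
    real (Suc (Poly_Mapping.lookup m i)) *
      Poly_Mapping.lookup p (m + Poly_Mapping.single i 1)"
proof -
  let ?e = "Poly_Mapping.single i (1::nat)"
  have *: "(real (Poly_Mapping.lookup n i) * Poly_Mapping.lookup p n when n - ?e = m) =
      (real (Suc (Poly_Mapping.lookup m i)) * Poly_Mapping.lookup p n when n = m + ?e)" for n
  proof (cases "Poly_Mapping.lookup n i = 0")
    case True
    then have "n \<noteq> m + ?e" by (auto simp: lookup_add)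
    with True show ?thesis by simp
  next
    case False
    then have "(n - ?e) + ?e = n"
      by (intro poly_mapping_eqI) (auto simp: lookup_add lookup_minus lookup_single when_def)
    then have "n - ?e = m \<longleftrightarrow> n = m + ?e" by auto
    then show ?thesis by (auto simp: when_def lookup_add)
  qed
  have "Poly_Mapping.lookup (partial_deriv i p) m =
     (\<Sum>n\<in>Poly_Mapping.keys p.
       real (Suc (Poly_Mapping.lookup m i)) * Poly_Mapping.lookup p n when n = m + ?e)"
    unfolding partial_deriv_def lookup_sum lookup_single * ..
  also have "\<dots> = real (Suc (Poly_Mapping.lookup m i)) * Poly_Mapping.lookup p (m + ?e)"
    by (auto simp: when_def sum.delta in_keys_iff)
  finally show ?thesis .
qed

lemma partial_deriv_commute:
  "partial_deriv i (partial_deriv j p) = partial_deriv j (partial_deriv i p)"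
  by (intro poly_mapping_eqI)
     (auto simp: lookup_partial_deriv lookup_add lookup_single when_def algebra_simps)

lemma partial_deriv_pow_commute:
  "(partial_deriv i ^^ k) ((partial_deriv j ^^ l) p) =
   (partial_deriv j ^^ l) ((partial_deriv i ^^ k) p)"
proof -
  have *: "partial_deriv i ((partial_deriv j ^^ l) q) = (partial_deriv j ^^ l) (partial_deriv i q)"
    for q
  proof (induction l)
    case (Suc l)
    then show ?case by (simp add: partial_deriv_commute[of i j])
  qed simp
  show ?thesis
  proof (induction k)
    case (Suc k)
    then show ?case by (simp add: *)
  qed simp
qed

lemma comp_fun_commute_partial_deriv:
  "comp_fun_commute (\<lambda>i. partial_deriv i ^^ Poly_Mapping.lookup n i)"
  by unfold_locales (auto simp: partial_deriv_pow_commute fun_eq_iff)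

lemma lookup_partial_deriv_pow:
  "Poly_Mapping.lookup ((partial_deriv i ^^ k) p) m =
    (\<Prod>r<k. real (Suc (Poly_Mapping.lookup m i) + r)) *
      Poly_Mapping.lookup p (m + Poly_Mapping.single i k)"
proof (induction k arbitrary: m)
  case 0
  then show ?case by simp
next
  case (Suc k)
  have "m + Poly_Mapping.single i 1 + Poly_Mapping.single i k = m + Poly_Mapping.single i (Suc k)"
    by (simp add: add.assoc flip: single_add)
  moreover have "(\<Prod>r<Suc k. real (Suc (Poly_Mapping.lookup m i) + r)) =
      real (Suc (Poly_Mapping.lookup m i)) * (\<Prod>r<k. real (Suc (Suc (Poly_Mapping.lookup m i)) + r))"
    by (subst prod.lessThan_Suc_shift) simp
  ultimately show ?case
    by (simp add: lookup_partial_deriv Suc.IH lookup_add mult.assoc del: prod.lessThan_Suc)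
qed

lemma lookup_iter_deriv:
  "Poly_Mapping.lookup (iter_deriv n p) m =
    (\<Prod>i\<in>UNIV. \<Prod>r<Poly_Mapping.lookup n i. real (Suc (Poly_Mapping.lookup m i) + r)) *
      Poly_Mapping.lookup p (m + n)"
proof -
  interpret comp_fun_commute "\<lambda>i. partial_deriv i ^^ Poly_Mapping.lookup n i"
    by (rule comp_fun_commute_partial_deriv)
  have "Poly_Mapping.lookup
      (Finite_Set.fold (\<lambda>i. partial_deriv i ^^ Poly_Mapping.lookup n i) p A) m =
      (\<Prod>i\<in>A. \<Prod>r<Poly_Mapping.lookup n i. real (Suc (Poly_Mapping.lookup m i) + r)) *
      Poly_Mapping.lookup p (m + (\<Sum>i\<in>A. Poly_Mapping.single i (Poly_Mapping.lookup n i)))"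
    if "finite A" for A
    using that
  proof (induction A arbitrary: m rule: finite_induct)
    case empty
    then show ?case by simp
  next
    case (insert x A)
    have "Poly_Mapping.lookup (m + Poly_Mapping.single x k) i = Poly_Mapping.lookup m i"
      if "i \<in> A" for i k
      using that insert.hyps by (auto simp: lookup_add lookup_single when_def)
    then show ?case
      using insert.hyps
      by (simp add: insert.IH lookup_partial_deriv_pow add.assoc mult.assoc)
  qed
  moreover have "(\<Sum>i\<in>UNIV. Poly_Mapping.single i (Poly_Mapping.lookup n i)) = n"
    by (intro poly_mapping_eqI) (simp add: lookup_sum lookup_single when_def)
  ultimately show ?thesis unfolding iter_deriv_def by simp
qed

lemma finite_exponent_splits:
  fixes n :: "'d::finite \<Rightarrow>\<^sub>0 nat"
  shows "finite {(k, l). k + l = n}"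
proof -
  let ?F = "{k :: 'd \<Rightarrow>\<^sub>0 nat. \<forall>i. Poly_Mapping.lookup k i \<le> Poly_Mapping.lookup n i}"
  have "Poly_Mapping.lookup ` ?F \<subseteq> PiE UNIV (\<lambda>i. {..Poly_Mapping.lookup n i})"
    by (simp add: image_subset_iff PiE_UNIV_domain)
  then have "finite (Poly_Mapping.lookup ` ?F)"
    by (rule finite_subset) (simp add: finite_PiE)
  then have "finite ?F"
    by (rule finite_imageD) (simp add: inj_on_def)
  then have "finite (?F \<times> ?F)"
    by (rule finite_cartesian_product) fact
  moreover have "{(k, l). k + l = n} \<subseteq> ?F \<times> ?F"
    by (auto simp: lookup_add)
  ultimately show ?thesis
    by (rule rev_finite_subset)
qed

lemma finite_iter_deriv_support: "finite {n. mscale (a n) (iter_deriv n p) \<noteq> 0}"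
proof (rule finite_subset)
  show "{n. mscale (a n) (iter_deriv n p) \<noteq> 0} \<subseteq>
      snd ` (\<Union>k\<in>Poly_Mapping.keys p. {(m, n). m + n = k})"
  proof
    fix n assume "n \<in> {n. mscale (a n) (iter_deriv n p) \<noteq> 0}"
    then obtain m where "Poly_Mapping.lookup (mscale (a n) (iter_deriv n p)) m \<noteq> 0"
      by (auto simp: poly_mapping_eq_iff fun_eq_iff)
    then have "m + n \<in> Poly_Mapping.keys p"
      by (auto simp: lookup_iter_deriv in_keys_iff)
    then show "n \<in> snd ` (\<Union>k\<in>Poly_Mapping.keys p. {(m, n). m + n = k})"
      by force
  qed
qed (simp add: finite_exponent_splits)

end

theory Submission
  imports Defs
begin

text \<open>
  Comparing the coefficients of \<open>t\<close> in \<open>T (p(x + t e\<^sub>i)) = (T p)(x + t e\<^sub>i)\<close> shows that a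
  shift-invariant \<open>T\<close> commutes with \<open>D\<^sub>i\<close>.  Hence the coefficient of \<open>x\<^sup>k\<close> in \<open>T p\<close> is the constant
  term of \<open>T (D\<^sup>k p)\<close> divided by \<open>k!\<close>, which gives the expansion \<open>T = \<Sum>\<^sub>n a\<^sub>n D\<^sup>n\<close> where
  \<open>n! a\<^sub>n\<close> is the constant term of \<open>T x\<^sup>n\<close>.
  The operator lowers the degree in \<open>x\<^sub>i\<close> by exactly one iff \<open>a\<^sub>n = 0\<close> whenever \<open>n\<^sub>i = 0\<close> and the
  coefficient of \<open>x\<^sub>i\<close> is nonzero: among the monomials of \<open>p\<close> of top degree in \<open>x\<^sub>i\<close>, one of maximal
  total degree contributes a term of \<open>T p\<close> that cannot cancel.
\<close>

section \<open>Coefficients of iterated derivatives and of series operators\<close>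

definition mfact :: "('d::finite \<Rightarrow>\<^sub>0 nat) \<Rightarrow> real" where
  "mfact n = (\<Prod>i\<in>UNIV. fact (Poly_Mapping.lookup n i))"

lemma mfact_nonzero [simp]: "mfact n \<noteq> 0"
  by (simp add: mfact_def)

lemma mfact_0 [simp]: "mfact 0 = 1"
  by (simp add: mfact_def)

text \<open>The rising products telescope to ratios of factorials. At \<open>m = 0\<close> the
  factor is just \<open>mfact n\<close>, so \<open>iter_deriv n\<close> carries the coefficient at
  \<open>n\<close> to the constant term.\<close>

lemma lookup_iter_deriv_mfact:
  "Poly_Mapping.lookup (iter_deriv n p) m = mfact (m + n) / mfact m * Poly_Mapping.lookup p (m + n)"
proof -
  have "(\<Prod>r<k. real (Suc j + r)) = fact (j + k) / fact j" for j k :: nat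
  proof (induction k)
    case (Suc k)
    have "(\<Prod>r<Suc k. real (Suc j + r)) = fact (j + k) / fact j * real (Suc (j + k))"
      unfolding prod.lessThan_Suc Suc.IH by simp
    also have "\<dots> = fact (j + Suc k) / fact j"
      by (simp only: add_Suc_right fact_Suc times_divide_eq_left times_divide_eq_right mult.commute)
    finally show ?case .
  qed simp
  then show ?thesis
    by (simp add: lookup_iter_deriv mfact_def prod_dividef lookup_add)
qed

lemma finite_exponents_above:
  fixes p :: "'d::finite mpoly"
  shows "finite {n. k + n \<in> Poly_Mapping.keys p}"
proof -
  have "finite ((+) k ` {n. k + n \<in> Poly_Mapping.keys p})"
    by (rule finite_subset[of _ "Poly_Mapping.keys p"]) auto
  then show ?thesis
    by (rule finite_imageD) (simp add: inj_on_def)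
qed

lemma lookup_series_op:
  "Poly_Mapping.lookup (series_op a p) k =
    (\<Sum>n | k + n \<in> Poly_Mapping.keys p. a n * (mfact (k + n) / mfact k * Poly_Mapping.lookup p (k + n)))"
proof -
  let ?S = "{n. mscale (a n) (iter_deriv n p) \<noteq> 0}"
  let ?K = "{n. k + n \<in> Poly_Mapping.keys p}"
  have fin: "finite (?S \<union> ?K)"
    using finite_iter_deriv_support finite_exponents_above by blast
  have "Poly_Mapping.lookup (series_op a p) k =
      (\<Sum>n\<in>?S \<union> ?K. Poly_Mapping.lookup (mscale (a n) (iter_deriv n p)) k)"
    unfolding series_op_def by (subst Sum_any.expand_superset[OF fin]) (auto simp: lookup_sum)
  also have "\<dots> = (\<Sum>n\<in>?K. Poly_Mapping.lookup (mscale (a n) (iter_deriv n p)) k)"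
    using fin by (intro sum.mono_neutral_right) (auto simp: lookup_iter_deriv_mfact in_keys_iff)
  finally show ?thesis
    by (simp add: lookup_iter_deriv_mfact)
qed

text \<open>In the constant term only the index \<open>n\<close> survives, so monomials recover
  every coefficient of the series; this is the source of uniqueness.\<close>

lemma lookup_series_op_monom_0:
  "Poly_Mapping.lookup (series_op a (Poly_Mapping.single n 1)) 0 = a n * mfact n"
  by (simp add: lookup_series_op)

lemma series_op_inject: "series_op a = series_op b \<longleftrightarrow> a = b"
proof
  assume "series_op a = series_op b"
  then have "a n * mfact n = b n * mfact n" for n
    by (metis lookup_series_op_monom_0)
  then show "a = b" by (auto simp: fun_eq_iff)
qed simp


section \<open>The expansion of shift-invariant operators\<close>

lemma mvar_power: "mvar i ^ k = Poly_Mapping.single (Poly_Mapping.single i k) 1"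
  by (induction k) (simp_all add: mvar_def mult_single flip: single_add)

lemma mconst_power: "mconst c ^ k = mconst (c ^ k)"
  by (induction k) (simp_all add: mconst_def mult_single)

lemma mconst_add_mvar_power:
  "(mvar i + mconst t) ^ m =
    (\<Sum>j\<le>m. Poly_Mapping.single (Poly_Mapping.single i (m - j)) (real (m choose j) * t ^ j))"
proof -
  have "(mvar i + mconst t) ^ m = (mconst t + mvar i) ^ m"
    by (simp add: add.commute)
  also have "\<dots> = (\<Sum>j\<le>m. of_nat (m choose j) * mconst t ^ j * mvar i ^ (m - j))"
    by (rule binomial_ring)
  also have "\<dots> = (\<Sum>j\<le>m. Poly_Mapping.single (Poly_Mapping.single i (m - j)) (real (m choose j) * t ^ j))"
    unfolding mvar_power mconst_power by (simp add: mconst_def mult_single flip: single_of_nat)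
  finally show ?thesis .
qed

lemma prod_mvar_power:
  "finite A \<Longrightarrow> (\<Prod>j\<in>A. mvar j ^ Poly_Mapping.lookup n j) =
    Poly_Mapping.single (\<Sum>j\<in>A. Poly_Mapping.single j (Poly_Mapping.lookup n j)) 1"
  by (induction A rule: finite_induct) (simp_all add: mvar_power mult_single)

text \<open>Also valid for \<open>j\<close> above the exponent of \<open>i\<close>: both sides then
  truncate to 0 at \<open>i\<close>.\<close>

lemma exponent_split:
  fixes n :: "'d::finite \<Rightarrow>\<^sub>0 nat"
  shows "Poly_Mapping.single i (Poly_Mapping.lookup n i - j) +
      (\<Sum>l\<in>UNIV - {i}. Poly_Mapping.single l (Poly_Mapping.lookup n l)) = n - Poly_Mapping.single i j"
  by (intro poly_mapping_eqI)
     (auto simp: lookup_add lookup_minus lookup_sum lookup_single when_def)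

lemma shift_monom_axis:
  fixes n :: "'d::finite \<Rightarrow>\<^sub>0 nat"
  shows "(\<Prod>l\<in>UNIV. (mvar l + mconst (axis i t $ l)) ^ Poly_Mapping.lookup n l) =
    (\<Sum>j\<le>Poly_Mapping.lookup n i.
      Poly_Mapping.single (n - Poly_Mapping.single i j) (real (Poly_Mapping.lookup n i choose j) * t ^ j))"
proof -
  have "(\<Prod>l\<in>UNIV. (mvar l + mconst (axis i t $ l)) ^ Poly_Mapping.lookup n l) =
      (mvar i + mconst t) ^ Poly_Mapping.lookup n i *
      (\<Prod>l\<in>UNIV - {i}. (mvar l + mconst (axis i t $ l)) ^ Poly_Mapping.lookup n l)"
    by (subst prod.remove[of UNIV i]) (simp_all add: axis_def)
  also have "(\<Prod>l\<in>UNIV - {i}. (mvar l + mconst (axis i t $ l)) ^ Poly_Mapping.lookup n l) =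
      (\<Prod>l\<in>UNIV - {i}. mvar l ^ Poly_Mapping.lookup n l)"
    by (intro prod.cong) (auto simp: axis_def mconst_def)
  finally show ?thesis
    by (simp add: prod_mvar_power mconst_add_mvar_power sum_distrib_right mult_single exponent_split)
qed

text \<open>
  The divided power \<open>D\<^sub>i\<^sup>j p / j!\<close>; truncation in the exponent only occurs where the binomial
  coefficient vanishes.
\<close>

definition taylor_coeff :: "'d::finite \<Rightarrow> nat \<Rightarrow> 'd mpoly \<Rightarrow> 'd mpoly" where
  "taylor_coeff i j p =
    (\<Sum>n\<in>Poly_Mapping.keys p.
      Poly_Mapping.single (n - Poly_Mapping.single i j)
        (real (Poly_Mapping.lookup n i choose j) * Poly_Mapping.lookup p n))"

lemma taylor_coeff_1: "taylor_coeff i 1 p = partial_deriv i p"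
  by (simp add: taylor_coeff_def partial_deriv_def)

lemma mscale_sum: "mscale c (sum g A) = (\<Sum>x\<in>A. mscale c (g x))"
  by (intro poly_mapping_eqI) (simp add: lookup_sum sum_distrib_left)

lemma mscale_0: "mscale c 0 = 0"
  by (intro poly_mapping_eqI) simp

lemma mscale_single: "mscale c (Poly_Mapping.single n b) = Poly_Mapping.single n (c * b)"
  by (intro poly_mapping_eqI) (simp add: lookup_single when_def)

text \<open>The bound \<open>M\<close> is free so that \<open>p\<close> and \<open>T p\<close> can
  be expanded over the same range of powers of \<open>t\<close>; the added terms have vanishing
  binomial coefficients.\<close>

lemma shift_axis:
  assumes "\<And>n. n \<in> Poly_Mapping.keys p \<Longrightarrow> Poly_Mapping.lookup n i \<le> M"
  shows "shift (axis i t) p = (\<Sum>j\<le>M. mscale (t ^ j) (taylor_coeff i j p))"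
proof -
  have "shift (axis i t) p = (\<Sum>n\<in>Poly_Mapping.keys p. \<Sum>j\<le>Poly_Mapping.lookup n i.
      mscale (t ^ j) (Poly_Mapping.single (n - Poly_Mapping.single i j)
        (real (Poly_Mapping.lookup n i choose j) * Poly_Mapping.lookup p n)))"
    by (simp add: shift_def shift_monom_axis mscale_sum mscale_single mult_ac)
  also have "\<dots> = (\<Sum>n\<in>Poly_Mapping.keys p. \<Sum>j\<le>M.
      mscale (t ^ j) (Poly_Mapping.single (n - Poly_Mapping.single i j)
        (real (Poly_Mapping.lookup n i choose j) * Poly_Mapping.lookup p n)))"
    using assms
    by (intro sum.cong[OF refl] sum.mono_neutral_left)
      (auto simp: mscale_0 binomial_eq_0 not_le[symmetric] intro: ccontr)
  also have "\<dots> = (\<Sum>j\<le>M. mscale (t ^ j) (taylor_coeff i j p))"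
    by (subst sum.swap) (simp add: taylor_coeff_def mscale_sum)
  finally show ?thesis .
qed

section \<open>Commutation with derivatives and the resulting expansion\<close>

lemma shift_invariant_commute_partial_deriv:
  assumes "shift_invariant T"
  shows "T (partial_deriv i p) = partial_deriv i (T p)"
proof (rule poly_mapping_eqI)
  fix m
  from assms interpret T: Vector_Spaces.linear mscale mscale T
    by (simp add: shift_invariant_def)
  \<comment> \<open>\<open>insert 0\<close> keeps the set nonempty for \<open>Max\<close>, and
    \<open>Suc\<close> makes \<open>M\<close> at least 1, so that the linear coefficient is always
    in range.\<close>
  define M where "M = Suc (Max ((\<lambda>n. Poly_Mapping.lookup n i) `
      (insert 0 (Poly_Mapping.keys p \<union> Poly_Mapping.keys (T p)))))"
  have M: "Poly_Mapping.lookup n i \<le> M"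
    if "n \<in> Poly_Mapping.keys p \<union> Poly_Mapping.keys (T p)" for n
    unfolding M_def using that by (intro le_SucI Max_ge) auto
  have "(\<Sum>j\<le>M. Poly_Mapping.lookup (T (taylor_coeff i j p)) m * t ^ j) =
      (\<Sum>j\<le>M. Poly_Mapping.lookup (taylor_coeff i j (T p)) m * t ^ j)" for t
  proof -
    have "T (shift (axis i t) p) = shift (axis i t) (T p)"
      using assms by (simp add: shift_invariant_def)
    then have "(\<Sum>j\<le>M. mscale (t ^ j) (T (taylor_coeff i j p))) =
        (\<Sum>j\<le>M. mscale (t ^ j) (taylor_coeff i j (T p)))"
      using M by (simp add: shift_axis[where M = M] T.sum T.scale)
    from arg_cong[OF this, of "\<lambda>q. Poly_Mapping.lookup q m"] show ?thesis
      by (simp add: lookup_sum mult.commute)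
  qed
  \<comment> \<open>For fixed \<open>m\<close> both sides are real polynomials in \<open>t\<close>
    that agree everywhere, hence coefficientwise.\<close>
  then have "\<forall>j\<le>M. Poly_Mapping.lookup (T (taylor_coeff i j p)) m =
      Poly_Mapping.lookup (taylor_coeff i j (T p)) m"
    by (subst polyfun_eq_coeffs[symmetric]) blast
  then have "Poly_Mapping.lookup (T (taylor_coeff i 1 p)) m =
      Poly_Mapping.lookup (taylor_coeff i 1 (T p)) m"
    by (simp add: M_def)
  then show "Poly_Mapping.lookup (T (partial_deriv i p)) m =
      Poly_Mapping.lookup (partial_deriv i (T p)) m"
    by (simp only: taylor_coeff_1)
qed

lemma shift_invariant_commute_iter_deriv:
  assumes "shift_invariant T"
  shows "T (iter_deriv n p) = iter_deriv n (T p)"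
proof -
  interpret comp_fun_commute "\<lambda>i. partial_deriv i ^^ Poly_Mapping.lookup n i"
    by (rule comp_fun_commute_partial_deriv)
  have pow: "T ((partial_deriv i ^^ k) q) = (partial_deriv i ^^ k) (T q)" for i k q
    by (induction k) (simp_all add: shift_invariant_commute_partial_deriv[OF assms])
  have "T (Finite_Set.fold (\<lambda>i. partial_deriv i ^^ Poly_Mapping.lookup n i) p A) =
      Finite_Set.fold (\<lambda>i. partial_deriv i ^^ Poly_Mapping.lookup n i) (T p) A" if "finite A" for A
    using that by (induction A rule: finite_induct) (simp_all add: pow)
  then show ?thesis by (simp add: iter_deriv_def)
qed

lemma mpoly_eq_sum_monom:
  "p = (\<Sum>n\<in>Poly_Mapping.keys p. mscale (Poly_Mapping.lookup p n) (Poly_Mapping.single n 1))"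
  by (intro poly_mapping_eqI)
     (auto simp: lookup_sum mscale_single lookup_single when_def in_keys_iff)

lemma shift_invariant_eq_series_op:
  fixes T :: "'d::finite mpoly \<Rightarrow> 'd mpoly"
  assumes "shift_invariant T"
  shows "T = series_op (\<lambda>n. Poly_Mapping.lookup (T (Poly_Mapping.single n 1)) 0 / mfact n)"
proof (intro ext poly_mapping_eqI)
  fix p :: "'d mpoly" and k
  from assms interpret T: Vector_Spaces.linear mscale mscale T
    by (simp add: shift_invariant_def)
  let ?\<phi> = "\<lambda>n. Poly_Mapping.lookup (T (Poly_Mapping.single n 1)) 0"
  have keys: "Poly_Mapping.keys (iter_deriv k p) = {n. k + n \<in> Poly_Mapping.keys p}"
    by (auto simp: in_keys_iff lookup_iter_deriv_mfact add.commute)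
  have "mfact k * Poly_Mapping.lookup (T p) k = Poly_Mapping.lookup (iter_deriv k (T p)) 0"
    by (simp add: lookup_iter_deriv_mfact)
  also have "\<dots> = Poly_Mapping.lookup (T (iter_deriv k p)) 0"
    by (simp add: shift_invariant_commute_iter_deriv[OF assms])
  also have "\<dots> = (\<Sum>n\<in>Poly_Mapping.keys (iter_deriv k p).
      Poly_Mapping.lookup (iter_deriv k p) n * ?\<phi> n)"
    by (subst (1) mpoly_eq_sum_monom) (simp add: T.sum T.scale lookup_sum)
  also have "\<dots> = (\<Sum>n | k + n \<in> Poly_Mapping.keys p.
      mfact (k + n) / mfact n * Poly_Mapping.lookup p (k + n) * ?\<phi> n)"
    unfolding keys by (simp add: lookup_iter_deriv_mfact add.commute)
  also have "\<dots> = mfact k * Poly_Mapping.lookup (series_op (\<lambda>n. ?\<phi> n / mfact n) p) k"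
    unfolding lookup_series_op sum_distrib_left by (intro sum.cong) simp_all
  finally show "Poly_Mapping.lookup (T p) k =
      Poly_Mapping.lookup (series_op (\<lambda>n. ?\<phi> n / mfact n) p) k"
    by simp
qed

lemma series_op_op_indicator:
  assumes "shift_invariant T"
  shows "series_op (op_indicator T) = T"
proof -
  obtain a where a: "T = series_op a"
    using shift_invariant_eq_series_op[OF assms] by blast
  have "op_indicator T = a"
    unfolding op_indicator_def using a by (intro the_equality) (auto simp: series_op_inject)
  with a show ?thesis by simp
qed


section \<open>Strictness in terms of the indicator\<close>

lemma exponent_minus_single_add:
  "Poly_Mapping.lookup n i \<noteq> 0 \<Longrightarrow>
    n - Poly_Mapping.single i (1::nat) + Poly_Mapping.single i 1 = n"
  by (intro poly_mapping_eqI) (auto simp: lookup_add lookup_minus lookup_single when_def)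

lemma mfps_mult_var:
  "mfps_mult (mfps_var i) g n =
    (if Poly_Mapping.lookup n i = 0 then 0 else g (n - Poly_Mapping.single i 1))"
proof -
  let ?e = "Poly_Mapping.single i (1::nat)"
  have "mfps_mult (mfps_var i) g n =
      (\<Sum>x\<in>{(k, l). k + l = n}. if x = (?e, n - ?e) then g (n - ?e) else 0)"
    unfolding mfps_mult_def by (intro sum.cong) (auto simp: mfps_var_def split: if_splits)
  also have "\<dots> = (if ?e + (n - ?e) = n then g (n - ?e) else 0)"
    by (simp add: sum.delta finite_exponent_splits)
  also have "?e + (n - ?e) = n \<longleftrightarrow> Poly_Mapping.lookup n i \<noteq> 0"
  proof
    assume "?e + (n - ?e) = n"
    then have "Poly_Mapping.lookup (?e + (n - ?e)) i = Poly_Mapping.lookup n i" by simp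
    then show "Poly_Mapping.lookup n i \<noteq> 0" by (simp add: lookup_add)
  qed (metis exponent_minus_single_add add.commute)
  finally show ?thesis by simp
qed

text \<open>Multiplication by the variable shifts exponents by one, so \<open>g\<close> must be
  \<open>a\<close> shifted back, and its constant term is the coefficient of that variable in
  \<open>a\<close>.\<close>

lemma mfps_factor_var_iff:
  "(\<exists>g. g 0 \<noteq> 0 \<and> a = mfps_mult (mfps_var i) g) \<longleftrightarrow>
    a (Poly_Mapping.single i 1) \<noteq> 0 \<and> (\<forall>n. Poly_Mapping.lookup n i = 0 \<longrightarrow> a n = 0)"
proof (intro iffI conjI)
  assume *: "a (Poly_Mapping.single i 1) \<noteq> 0 \<and> (\<forall>n. Poly_Mapping.lookup n i = 0 \<longrightarrow> a n = 0)"
  define g where "g n = a (n + Poly_Mapping.single i 1)" for n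
  have "a = mfps_mult (mfps_var i) g"
  proof
    fix n show "a n = mfps_mult (mfps_var i) g n"
      using * exponent_minus_single_add[of n i] by (simp add: mfps_mult_var g_def)
  qed
  with * show "\<exists>g. g 0 \<noteq> 0 \<and> a = mfps_mult (mfps_var i) g"
    by (intro exI[of _ g]) (simp add: g_def)
qed (auto simp: mfps_mult_var)

lemma series_op_lowers_degree:
  assumes a1: "a (Poly_Mapping.single i 1) \<noteq> 0"
    and a0: "\<And>n. Poly_Mapping.lookup n i = 0 \<Longrightarrow> a n = 0"
    and deg: "has_degree_in i p m" and m: "m \<ge> 1"
  shows "has_degree_in i (series_op a p) (m - 1)"
proof -
  let ?e = "Poly_Mapping.single i (1::nat)"
  let ?td = "\<lambda>n :: 'a \<Rightarrow>\<^sub>0 nat. \<Sum>j\<in>UNIV. Poly_Mapping.lookup n j"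
  have le: "Poly_Mapping.lookup n i \<le> m" if "n \<in> Poly_Mapping.keys p" for n
    using deg that by (simp add: has_degree_in_def)
  have upper: "Poly_Mapping.lookup k i \<le> m - 1" if k: "k \<in> Poly_Mapping.keys (series_op a p)" for k
  proof (rule ccontr)
    assume "\<not> Poly_Mapping.lookup k i \<le> m - 1"
    \<comment> \<open>The exponent of \<open>k\<close> at \<open>i\<close> already reaches
      \<open>m\<close>, so nothing is left for \<open>n\<close> there and \<open>a0\<close> kills
      every term.\<close>
    then have "Poly_Mapping.lookup n i = 0" if "k + n \<in> Poly_Mapping.keys p" for n
      using le[OF that] by (simp add: lookup_add)
    then have "Poly_Mapping.lookup (series_op a p) k = 0"
      unfolding lookup_series_op using a0 by (intro sum.neutral) simp
    with k show False by (simp add: in_keys_iff)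
  qed
  define S where "S = {n \<in> Poly_Mapping.keys p. Poly_Mapping.lookup n i = m}"
  have S: "finite S" "S \<noteq> {}"
    using deg by (auto simp: S_def has_degree_in_def intro: antisym)
  then have "Max (?td ` S) \<in> ?td ` S" by simp
  then obtain N where N: "N \<in> S" "?td N = Max (?td ` S)" by auto
  have max: "?td n \<le> ?td N" if "n \<in> S" for n
    using N(2) that S(1) by simp
  \<comment> \<open>At this exponent the term for \<open>?e\<close> is the only one that
    survives.\<close>
  define k where "k = N - ?e"
  have kN: "k + ?e = N"
    unfolding k_def using N(1) m by (intro exponent_minus_single_add) (simp add: S_def)
  have other: "a n = 0" if n: "k + n \<in> Poly_Mapping.keys p" and "n \<noteq> ?e" for n
  proof (rule ccontr)
    assume "a n \<noteq> 0"
    then have ni: "Poly_Mapping.lookup n i \<noteq> 0" using a0 by blast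
    \<comment> \<open>A further contributing \<open>n\<close> would be \<open>l + ?e\<close> with
      \<open>l\<close> nonzero and free of \<open>i\<close>; then \<open>N + l\<close> would lie in
      \<open>S\<close> with larger total degree than \<open>N\<close>.\<close>
    define l where "l = n - ?e"
    have nl: "n = l + ?e"
      using exponent_minus_single_add[OF ni] by (simp add: l_def)
    have knl: "k + n = N + l" by (simp add: nl flip: kN add.assoc) (simp add: ac_simps)
    have "Poly_Mapping.lookup l i = 0"
      using le[OF n] N(1) by (simp add: knl lookup_add S_def)
    with n N(1) have "N + l \<in> S" by (simp add: knl S_def lookup_add)
    from max[OF this] have "l = 0"
      by (intro poly_mapping_eqI) (simp add: lookup_add sum.distrib)
    with nl \<open>n \<noteq> ?e\<close> show False by simp
  qed
  have "Poly_Mapping.lookup (series_op a p) k =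
      (\<Sum>n\<in>{?e}. a n * (mfact (k + n) / mfact k * Poly_Mapping.lookup p (k + n)))"
    unfolding lookup_series_op using N(1) other
    by (intro sum.mono_neutral_right finite_exponents_above) (auto simp: kN[simplified] S_def)
  also have "\<dots> \<noteq> 0"
    using a1 N(1) by (simp add: kN[simplified] S_def in_keys_iff)
  finally have "k \<in> Poly_Mapping.keys (series_op a p)" by (simp add: in_keys_iff)
  moreover have "Poly_Mapping.lookup k i = m - 1"
    using N(1) by (simp add: k_def S_def lookup_minus)
  ultimately show ?thesis
    unfolding has_degree_in_def using upper by (metis order_refl)
qed

text \<open>If \<open>p\<close> is free of the variable, so is every derivative exponent that can
  act on it, and all those coefficients vanish.\<close>

lemma series_op_eq_0:
  assumes "\<And>n. Poly_Mapping.lookup n i = 0 \<Longrightarrow> a n = 0" and "has_degree_in i p 0"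
  shows "series_op a p = 0"
proof (rule poly_mapping_eqI)
  fix k
  have "Poly_Mapping.lookup n i = 0" if "k + n \<in> Poly_Mapping.keys p" for n
    using assms(2) that by (auto simp: has_degree_in_def lookup_add)
  then show "Poly_Mapping.lookup (series_op a p) k = Poly_Mapping.lookup 0 k"
    unfolding lookup_series_op using assms(1) by (simp add: sum.neutral)
qed

lemma has_degree_in_monom:
  "has_degree_in i (Poly_Mapping.single n 1) m \<longleftrightarrow> m = Poly_Mapping.lookup n i"
  by (auto simp: has_degree_in_def)

lemma series_op_strict_iff:
  "(\<forall>p m. has_degree_in i p m \<longrightarrow>
      (m \<ge> 1 \<longrightarrow> has_degree_in i (series_op a p) (m - 1)) \<and> (m = 0 \<longrightarrow> series_op a p = 0)) \<longleftrightarrow>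
    a (Poly_Mapping.single i 1) \<noteq> 0 \<and> (\<forall>n. Poly_Mapping.lookup n i = 0 \<longrightarrow> a n = 0)"
  (is "?L \<longleftrightarrow> ?R")
proof
  assume L: ?L
  have a0: "a n = 0" if "Poly_Mapping.lookup n i = 0" for n
  proof -
    have "series_op a (Poly_Mapping.single n 1) = 0"
      using L that by (simp add: has_degree_in_monom)
    with lookup_series_op_monom_0[of a n] show ?thesis by simp
  qed
  let ?x = "Poly_Mapping.single (Poly_Mapping.single i (1::nat)) (1::real)"
  \<comment> \<open>Having a degree entails being nonzero, so some term of the image of the variable
    survives.\<close>
  have "has_degree_in i (series_op a ?x) 0"
    using L[rule_format, of ?x 1] by (simp add: has_degree_in_monom)
  then obtain k where k: "k \<in> Poly_Mapping.keys (series_op a ?x)"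
    by (auto simp: has_degree_in_def)
  then obtain n where "k + n \<in> Poly_Mapping.keys ?x" "a n \<noteq> 0"
    unfolding in_keys_iff[of k] lookup_series_op
    by (rule sum.not_neutral_contains_not_neutral) auto
  then have n: "k + n = Poly_Mapping.single i 1" "a n \<noteq> 0"
    by simp_all
  then have "Poly_Mapping.lookup n i \<noteq> 0" using a0 by blast
  \<comment> \<open>\<open>k\<close> and \<open>n\<close> add up to a unit exponent, and
    \<open>n\<close> already takes up the whole unit.\<close>
  have "n = Poly_Mapping.single i 1"
  proof (rule poly_mapping_eqI)
    fix j
    have "Poly_Mapping.lookup k j + Poly_Mapping.lookup n j =
        Poly_Mapping.lookup (Poly_Mapping.single i 1) j"
      by (simp add: n(1) flip: lookup_add)
    with \<open>Poly_Mapping.lookup n i \<noteq> 0\<close>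
    show "Poly_Mapping.lookup n j = Poly_Mapping.lookup (Poly_Mapping.single i 1) j"
      by (auto simp: lookup_single when_def split: if_splits)
  qed
  with n(2) a0 show ?R by simp
next
  assume ?R
  then show ?L
    using series_op_lowers_degree[of a i] series_op_eq_0[of i a] by blast
qed

theorem theorem2:
  fixes T :: "'d::finite \<Rightarrow> 'd mpoly \<Rightarrow> 'd mpoly"
    and f :: "'d \<Rightarrow> 'd mfps"
  assumes "delta_system T"
    and "\<And>i. f i = op_indicator (T i)"
  shows "strict_delta_system T \<longleftrightarrow>
    (\<forall>i. \<exists>g :: 'd mfps. g 0 \<noteq> 0 \<and> f i = mfps_mult (mfps_var i) g)"
proof -
  have T: "T i = series_op (f i)" for i
    using assms by (simp add: delta_system_def series_op_op_indicator)
  show ?thesis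
    \<comment> \<open>Both sides become the degree condition on each \<open>series_op (f i)\<close>:
      the factorization passes through its coefficient form, and the delta part of strictness is
      \<open>assms(1)\<close>.\<close>
    unfolding strict_delta_system_def mfps_factor_var_iff series_op_strict_iff[symmetric]
    using assms(1) T by simp
qed

end
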